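(* Let $F=(V,E)$ be a forest. The subgraph counting polynomial $H(F,v,x,y)$ and the subgraph component polynomial $Q(F,v,x)$ are related by $$H(F,v,x,y)=Q\left(F,\,v(x+y),\,\frac{x}{x+y}\right),$$ $$Q(F,v,x)=H(F,v,x,1-x),$$ where the first is an identity of rational functions in $v,x,y$ and the second of polynomials in $v,x$.
   Context: Graphs are finite. A forest is a graph without cycles (in particular without loops and parallel edges). For a graph $G=(V,E)$, $k(G)$ denotes the number of connected components (the graph with no vertices has $0$ components). A subgraph $H=(W,A)\subseteq G$ is a graph with $W\subseteq V$ and $A\subseteq E$ (all edges in $A$ are subsets of $W$). For $W\subseteq V$, $G[W]=(W,\{e\in E\mid e\subseteq W\})$ is the induced subgraph. Subgraph counting polynomial: $H(G,v,x,y)=\sum_{H=(W,A)\subseteq G} v^{|W|}x^{k(H)}y^{|A|}$. Subgraph component polynomial: $Q(G,v,x)=\sum_{W\subseteq V} v^{|W|}x^{k(G[W])}$. *)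

theory Defs
  imports "HOL-Computational_Algebra.Computational_Algebra"
begin

text \<open>Graphs may have loops and parallel edges: edges are labels, and \<open>ends\<close> maps a label to its
  set of end vertices (a singleton for a loop). Edges that are themselves vertex sets are the
  case where \<open>ends\<close> is the identity.\<close>

record ('v, 'e) mgraph =
  verts :: "'v set"
  edges :: "'e set"
  ends :: "'e \<Rightarrow> 'v set"

definition is_graph :: "('v, 'e) mgraph \<Rightarrow> bool" where
  "is_graph G \<longleftrightarrow> finite (verts G) \<and> finite (edges G) \<and>
     (\<forall>e\<in>edges G. ends G e \<subseteq> verts G \<and> card (ends G e) \<in> {1, 2})"

definition subgraph :: "('v, 'e) mgraph \<Rightarrow> ('v, 'e) mgraph \<Rightarrow> bool" where
  "subgraph H G \<longleftrightarrow> is_graph H \<and> verts H \<subseteq> verts G \<and> edges H \<subseteq> edges G \<and> ends H = ends G"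

definition induced :: "('v, 'e) mgraph \<Rightarrow> 'v set \<Rightarrow> ('v, 'e) mgraph" where
  "induced G W = \<lparr>verts = W, edges = {e \<in> edges G. ends G e \<subseteq> W}, ends = ends G\<rparr>"

definition adjacency :: "('v, 'e) mgraph \<Rightarrow> ('v \<times> 'v) set" where
  "adjacency G = {(u, w). \<exists>e\<in>edges G. ends G e = {u, w}}"

definition connectivity :: "('v, 'e) mgraph \<Rightarrow> ('v \<times> 'v) set" where
  "connectivity G = {(u, w). u \<in> verts G \<and> w \<in> verts G \<and> (u, w) \<in> (adjacency G)\<^sup>*}"

definition num_components :: "('v, 'e) mgraph \<Rightarrow> nat" where
  "num_components G = card (verts G // connectivity G)"

text \<open>The cycle \<open>us ! 0, es ! 0, us ! 1, es ! 1, \<dots>\<close> closes up by the index \<open>mod\<close> the length.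
  Length 1 is a loop, length 2 a pair of parallel edges.\<close>

definition is_cycle :: "('v, 'e) mgraph \<Rightarrow> 'v list \<Rightarrow> 'e list \<Rightarrow> bool" where
  "is_cycle G us es \<longleftrightarrow> es \<noteq> [] \<and> length us = length es \<and> distinct us \<and> distinct es \<and>
     set us \<subseteq> verts G \<and> set es \<subseteq> edges G \<and>
     (\<forall>i<length es. ends G (es ! i) = {us ! i, us ! (Suc i mod length es)})"

definition forest :: "('v, 'e) mgraph \<Rightarrow> bool" where
  "forest G \<longleftrightarrow> is_graph G \<and> (\<nexists>us es. is_cycle G us es)"

text \<open>Polynomials in \<open>v, x\<close> and in \<open>v, x, y\<close> are iterated univariate polynomials, with \<open>v\<close> the
  outermost variable, then \<open>x\<close>, then \<open>y\<close>. Hence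
  \<open>monom (monom (monom 1 k) j) i\<close> is the monomial \<open>v ^ i * x ^ j * y ^ k\<close>.\<close>

definition indet_v :: "'a::comm_semiring_1 poly" where
  "indet_v = [:0, 1:]"

definition indet_x :: "'a::comm_semiring_1 poly poly" where
  "indet_x = [:[:0, 1:]:]"

definition indet_y :: "'a::comm_semiring_1 poly poly poly" where
  "indet_y = [:[:[:0, 1:]:]:]"

definition subst_vx :: "int poly poly \<Rightarrow> 'a::comm_ring_1 \<Rightarrow> 'a \<Rightarrow> 'a" where
  "subst_vx p v x = poly (map_poly (\<lambda>q. poly (map_poly of_int q) x) p) v"

definition subst_vxy :: "int poly poly poly \<Rightarrow> 'a::comm_ring_1 \<Rightarrow> 'a \<Rightarrow> 'a \<Rightarrow> 'a" where
  "subst_vxy p v x y = poly (map_poly (\<lambda>q. subst_vx q x y) p) v"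

definition subgraph_counting_poly :: "('v, 'e) mgraph \<Rightarrow> int poly poly poly" where
  "subgraph_counting_poly G = (\<Sum>H | subgraph H G.
     monom (monom (monom 1 (card (edges H))) (num_components H)) (card (verts H)))"

definition subgraph_component_poly :: "('v, 'e) mgraph \<Rightarrow> int poly poly" where
  "subgraph_component_poly G = (\<Sum>W\<in>Pow (verts G).
     monom (monom 1 (num_components (induced G W))) (card W))"

lemma finite_subgraphs:
  assumes "is_graph G"
  shows "finite {H. subgraph H G}"
proof (rule finite_subset)
  show "{H. subgraph H G} \<subseteq>
      (\<lambda>(W, A). \<lparr>verts = W, edges = A, ends = ends G\<rparr>) ` (Pow (verts G) \<times> Pow (edges G))"
  proof
    fix H assume "H \<in> {H. subgraph H G}"
    then have "H = (\<lambda>(W, A). \<lparr>verts = W, edges = A, ends = ends G\<rparr>) (verts H, edges H)"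
      and "(verts H, edges H) \<in> Pow (verts G) \<times> Pow (edges G)"
      by (auto simp: subgraph_def)
    then show "H \<in> (\<lambda>(W, A). \<lparr>verts = W, edges = A, ends = ends G\<rparr>) `
        (Pow (verts G) \<times> Pow (edges G))"
      by (rule image_eqI)
  qed
  show "finite ((\<lambda>(W, A). \<lparr>verts = W, edges = A, ends = ends G\<rparr>) `
      (Pow (verts G) \<times> Pow (edges G)))"
    using assms by (auto simp: is_graph_def)
qed

lemma subst_vx_0 [simp]: "subst_vx 0 v x = 0"
  by (simp add: subst_vx_def)

lemma subst_vx_monom: "subst_vx (monom (monom c j) i) v x = of_int c * v ^ i * x ^ j"
  by (simp add: subst_vx_def map_poly_monom poly_monom algebra_simps)

lemma subst_vxy_monom:
  "subst_vxy (monom (monom (monom c k) j) i) v x y = of_int c * v ^ i * x ^ j * y ^ k"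
  by (simp add: subst_vxy_def map_poly_monom poly_monom subst_vx_monom algebra_simps)

lemma indet_monom:
  "indet_v ^ i * indet_x ^ j * indet_y ^ k = monom (monom (monom 1 k) j) i"
  by (simp add: indet_v_def indet_x_def indet_y_def monom_altdef poly_const_pow
      smult_power [symmetric] algebra_simps)

end

theory Submission
  imports Defs
begin

text \<open>A forest with \<open>n\<close> vertices and \<open>m\<close> edges has \<open>n - m\<close> components
  (\<open>forest_num_components\<close>): every edge is a bridge, so that deleting the edges one at a time
  produces one new component at each step.

  A subgraph of a forest \<open>F\<close> is a vertex set \<open>W\<close> with a set \<open>A\<close> of edges of \<open>F[W]\<close>, and it is
  again a forest. With \<open>E\<^sub>W\<close> for the edge set and \<open>k\<^sub>W\<close> for the number of components of \<open>F[W]\<close>, the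
  subgraph \<open>(W, A)\<close> therefore has \<open>k\<^sub>W + |E\<^sub>W| - |A|\<close> components, a number that depends on \<open>A\<close> only
  through its size. Summing over \<open>A\<close> by the binomial theorem gives
  \<open>\<Sum>A. x ^ k(W, A) * y ^ |A| = x ^ k\<^sub>W * (x + y) ^ |E\<^sub>W|\<close> with \<open>|E\<^sub>W| = |W| - k\<^sub>W\<close>, and hence
  (\<open>subst_subgraph_counting_poly_forest\<close>)
  \<open>H(F, v, x, y) = \<Sum>W. v ^ |W| * x ^ k\<^sub>W * (x + y) ^ (|W| - k\<^sub>W)\<close>.

  This holds at arbitrary elements \<open>v, x, y\<close> of any commutative ring, and both identities are
  instances. In the field of fractions \<open>x + y\<close> is invertible, and the summand is
  \<open>(v * (x + y)) ^ |W| * (x / (x + y)) ^ k\<^sub>W\<close>. For \<open>y = 1 - x\<close> the factor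
  \<open>x + y\<close> is \<open>1\<close>, which leaves \<open>Q(F, v, x)\<close>.\<close>

section \<open>Counting components of a forest\<close>

text \<open>Adding \<open>B \<times> B\<close> to \<open>R\<close> fuses the two distinct classes of \<open>a\<close> and \<open>b\<close> into the single class
  \<open>B\<close> and leaves the other classes alone. This is how a new edge between two components acts on
  the set of components.\<close>

lemma card_quotient_merge:
  assumes R: "equiv A R" and fin: "finite A" and a: "a \<in> A" and b: "b \<in> A" and ab: "(a, b) \<notin> R"
  defines "B \<equiv> R `` {a} \<union> R `` {b}"
  shows "card (A // R) = Suc (card (A // (R \<union> B \<times> B)))"
proof -
  have class_outside: "(R \<union> B \<times> B) `` {z} = R `` {z}" if "z \<notin> B" for z
    using that by auto
  have class_inside: "(R \<union> B \<times> B) `` {z} = B" if "z \<in> B" for z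
    using that R unfolding B_def equiv_def sym_def trans_def by blast
  have classes_in_B: "R `` {z} \<in> {R `` {a}, R `` {b}} \<longleftrightarrow> z \<in> B" if "z \<in> A" for z
    using that R a b eq_equiv_class_iff[OF R] unfolding B_def by (auto simp: equiv_def sym_def)
  have "a \<in> B"
    using R a by (auto simp: B_def equiv_def refl_on_def)
  have quotient: "A // (R \<union> B \<times> B) = insert B (A // R - {R `` {a}, R `` {b}})"
  proof (intro equalityI subsetI)
    fix X assume "X \<in> A // (R \<union> B \<times> B)"
    then obtain z where "z \<in> A" "X = (R \<union> B \<times> B) `` {z}"
      by (auto elim: quotientE)
    then show "X \<in> insert B (A // R - {R `` {a}, R `` {b}})"
      using classes_in_B class_inside class_outside by (cases "z \<in> B") (auto intro: quotientI)
  next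
    fix X assume "X \<in> insert B (A // R - {R `` {a}, R `` {b}})"
    then show "X \<in> A // (R \<union> B \<times> B)"
    proof
      assume "X = B"
      then show ?thesis
        using quotientI[OF a, of "R \<union> B \<times> B"] class_inside[OF \<open>a \<in> B\<close>] by simp
    next
      assume X: "X \<in> A // R - {R `` {a}, R `` {b}}"
      then obtain z where z: "z \<in> A" "X = R `` {z}"
        by (auto elim: quotientE)
      then have "z \<notin> B"
        using X classes_in_B by blast
      then show ?thesis
        using quotientI[OF z(1), of "R \<union> B \<times> B"] class_outside z(2) by simp
    qed
  qed
  have "B \<notin> A // R"
  proof
    assume "B \<in> A // R"
    moreover have "a \<in> B" "b \<in> B"
      using R a b by (auto simp: B_def equiv_def refl_on_def)
    ultimately show False
      using ab R by (meson quotient_eq_iff)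
  qed
  have distinct: "R `` {a} \<noteq> R `` {b}"
    using ab a b R by (simp add: eq_equiv_class_iff)
  let ?Q = "A // R - {R `` {a}, R `` {b}}"
  have finite: "finite ?Q"
    using fin R by (simp add: finite_quotient equiv_type)
  have "A // R = insert (R `` {a}) (insert (R `` {b}) ?Q)"
    using quotientI[OF a, of R] quotientI[OF b, of R] by blast
  then have "card (A // R) = card (insert (R `` {a}) (insert (R `` {b}) ?Q))"
    by simp
  also have "\<dots> = Suc (Suc (card ?Q))"
    using finite distinct by simp
  also have "Suc (card ?Q) = card (A // (R \<union> B \<times> B))"
    using finite \<open>B \<notin> A // R\<close> by (simp add: quotient)
  finally show ?thesis .
qed

lemma equiv_connectivity:
  "equiv (verts G) (connectivity G)"
proof (rule equivI)
  have "sym (adjacency G)"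
    by (auto simp: sym_def adjacency_def insert_commute)
  then have "sym ((adjacency G)\<^sup>*)"
    by (rule sym_rtrancl)
  then show "sym (connectivity G)"
    by (auto simp: sym_def connectivity_def)
qed (auto simp: connectivity_def refl_on_def trans_def)

text \<open>Restoring the edge \<open>e\<close> can only link the components of its two ends in \<open>G'\<close>. The right-hand
  side is transitive because a component of \<open>G'\<close> lies inside or outside \<open>B\<close>, so it absorbs every
  walk in \<open>G\<close>. The ends may already be connected in \<open>G'\<close>; then both sides are the
  connectivity of \<open>G'\<close>.\<close>

lemma connectivity_insert_edge:
  assumes G: "is_graph G" and e: "e \<in> edges G" "ends G e = {a, b}"
  defines "G' \<equiv> G\<lparr>edges := edges G - {e}\<rparr>"
  defines "B \<equiv> connectivity G' `` {a} \<union> connectivity G' `` {b}"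
  shows "connectivity G = connectivity G' \<union> B \<times> B"
proof -
  let ?R' = "connectivity G' \<union> B \<times> B"
  have R: "equiv (verts G) (connectivity G')"
    using equiv_connectivity[of G'] by (simp add: G'_def)
  have a: "a \<in> verts G" and b: "b \<in> verts G"
    using G e unfolding is_graph_def by (metis insert_subset)+
  have aB: "a \<in> B" and bB: "b \<in> B"
    using R a b by (auto simp: B_def equiv_def refl_on_def)
  have sub: "connectivity G' \<subseteq> connectivity G"
  proof -
    have "(adjacency G')\<^sup>* \<subseteq> (adjacency G)\<^sup>*"
      by (rule rtrancl_mono) (auto simp: adjacency_def G'_def)
    then show ?thesis
      by (auto simp: connectivity_def G'_def)
  qed
  have sym_G: "sym (connectivity G)" and trans_G: "trans (connectivity G)"
    using equiv_connectivity[of G] by (simp_all add: equiv_def)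
  have "(a, b) \<in> connectivity G"
    using a b e by (auto simp: connectivity_def adjacency_def)
  then have "(a, z) \<in> connectivity G" if "z \<in> B" for z
    using that sub trans_G by (auto simp: B_def dest: transD)
  then have "B \<times> B \<subseteq> connectivity G"
    using symD[OF sym_G] transD[OF trans_G] by blast
  then have "?R' \<subseteq> connectivity G"
    using sub by blast
  moreover have "connectivity G \<subseteq> ?R'"
  proof -
    have sym': "sym (connectivity G')" and trans': "trans (connectivity G')"
      using R by (simp_all add: equiv_def)
    have closed: "y \<in> B \<longleftrightarrow> z \<in> B" if "(y, z) \<in> connectivity G'" for y z
      using that symD[OF sym' that] transD[OF trans'] unfolding B_def by blast
    have trans: "(s, u) \<in> ?R'" if "(s, t) \<in> ?R'" "(t, u) \<in> ?R'" for s t u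
      using that closed transD[OF trans'] by blast
    have edge: "(y, z) \<in> ?R'" if yz: "(y, z) \<in> adjacency G" for y z
    proof -
      obtain f where f: "f \<in> edges G" "ends G f = {y, z}"
        using yz by (auto simp: adjacency_def)
      then have "y \<in> verts G" "z \<in> verts G"
        using G unfolding is_graph_def by (metis insert_subset)+
      show ?thesis
      proof (cases "f = e")
        case True
        then show ?thesis
          using f e aB bB by (auto simp: doubleton_eq_iff)
      next
        case False
        then have "(y, z) \<in> adjacency G'"
          using f by (auto simp: adjacency_def G'_def)
        then show ?thesis
          using \<open>y \<in> verts G\<close> \<open>z \<in> verts G\<close> by (auto simp: connectivity_def G'_def)
      qed
    qed
    have "(y, z) \<in> ?R'" if "(y, z) \<in> (adjacency G)\<^sup>*" "y \<in> verts G" for y z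
      using that(1)
    proof induction
      case base
      then show ?case
        using R that(2) by (auto simp: equiv_def refl_on_def)
    next
      case (step y' z)
      then show ?case
        using trans edge by blast
    qed
    then show ?thesis
      by (auto simp only: connectivity_def)
  qed
  ultimately show ?thesis
    by blast
qed

lemma num_components_delete_bridge:
  assumes G: "is_graph G" and e: "e \<in> edges G" "ends G e = {a, b}"
    and bridge: "(a, b) \<notin> connectivity (G\<lparr>edges := edges G - {e}\<rparr>)"
  shows "num_components (G\<lparr>edges := edges G - {e}\<rparr>) = Suc (num_components G)"
proof -
  let ?G' = "G\<lparr>edges := edges G - {e}\<rparr>"
  have "a \<in> verts G" "b \<in> verts G" "finite (verts G)"
    using G e unfolding is_graph_def by (metis insert_subset)+
  moreover have "equiv (verts G) (connectivity ?G')"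
    using equiv_connectivity[of ?G'] by simp
  ultimately show ?thesis
    using card_quotient_merge[of "verts G" "connectivity ?G'" a b] bridge
      connectivity_insert_edge[OF G e]
    by (simp add: num_components_def)
qed

text \<open>A walk extends by one step to a path: a step to a new vertex is appended, and a step back to a
  vertex of the path cuts the path off there.\<close>

lemma connected_imp_simple_path:
  assumes "(u, w) \<in> (adjacency G)\<^sup>*"
  obtains us es where "length us = Suc (length es)" "us ! 0 = u" "us ! length es = w"
    "distinct us" "set es \<subseteq> edges G" "\<forall>i<length es. ends G (es ! i) = {us ! i, us ! Suc i}"
proof -
  have "\<exists>us es. length us = Suc (length es) \<and> us ! 0 = u \<and> us ! length es = w \<and>
    distinct us \<and> set es \<subseteq> edges G \<and> (\<forall>i<length es. ends G (es ! i) = {us ! i, us ! Suc i})"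
    using assms
  proof induction
    case base
    show ?case
      by (intro exI[of _ "[u]"] exI[of _ "[]"]) simp
  next
    case (step y z)
    then obtain us es where p: "length us = Suc (length es)" "us ! 0 = u" "us ! length es = y"
      "distinct us" "set es \<subseteq> edges G" "\<forall>i<length es. ends G (es ! i) = {us ! i, us ! Suc i}"
      by blast
    show ?case
    proof (cases "z \<in> set us")
      case True
      then obtain k where "k \<le> length es" "us ! k = z"
        using p(1) by (metis in_set_conv_nth less_Suc_eq_le)
      then show ?thesis
        using p set_take_subset[of k es]
        by (intro exI[of _ "take (Suc k) us"] exI[of _ "take k es"]) auto
    next
      case False
      obtain f where "f \<in> edges G" "ends G f = {y, z}"
        using step by (auto simp: adjacency_def)
      then show ?thesis
        using p False
        by (intro exI[of _ "us @ [z]"] exI[of _ "es @ [f]"]) (auto simp: nth_append less_Suc_eq)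
    qed
  qed
  then show ?thesis
    using that by blast
qed

text \<open>If the ends of \<open>e\<close> stayed connected without \<open>e\<close>, then a simple path between them would close up
  with \<open>e\<close> to a cycle. A loop is covered as well: its path has length 0, and the cycle is the loop
  alone.\<close>

lemma forest_edge_is_bridge:
  assumes F: "forest G" and e: "e \<in> edges G" "ends G e = {a, b}"
  shows "(a, b) \<notin> connectivity (G\<lparr>edges := edges G - {e}\<rparr>)"
proof
  let ?G' = "G\<lparr>edges := edges G - {e}\<rparr>"
  assume "(a, b) \<in> connectivity ?G'"
  then have "(a, b) \<in> (adjacency ?G')\<^sup>*" and a: "a \<in> verts G"
    by (auto simp: connectivity_def)
  then obtain us es where len: "length us = Suc (length es)"
    and first: "us ! 0 = a" and last: "us ! length es = b"
    and us: "distinct us" and es: "set es \<subseteq> edges G - {e}"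
    and path: "\<forall>i<length es. ends G (es ! i) = {us ! i, us ! Suc i}"
    by (elim connected_imp_simple_path) auto
  \<comment> \<open>Two steps of a path with distinct vertices have different end sets, so no edge repeats.\<close>
  have "distinct es"
  proof (rule ccontr)
    assume "\<not> distinct es"
    then obtain i j where ij: "i < length es" "j < length es" "i \<noteq> j" "es ! i = es ! j"
      by (auto simp: distinct_conv_nth)
    then have "{us ! i, us ! Suc i} = {us ! j, us ! Suc j}"
      using path by metis
    then show False
      using ij len us by (auto simp: doubleton_eq_iff nth_eq_iff_index_eq)
  qed
  moreover have "us ! i \<in> verts G" if "i < length us" for i
  proof (cases i)
    case 0
    then show ?thesis
      using a first by simp
  next
    case (Suc j)
    then have j: "j < length es"
      using that len by simp
    then have "es ! j \<in> edges G"
      using es nth_mem by blast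
    then have "ends G (es ! j) \<subseteq> verts G"
      using F by (auto simp: forest_def is_graph_def)
    then show ?thesis
      using path j Suc by auto
  qed
  then have "set us \<subseteq> verts G"
    by (auto simp: in_set_conv_nth)
  \<comment> \<open>At the last index, the vertex after \<open>b\<close> wraps around to \<open>a\<close>, and the edge is \<open>e\<close>.\<close>
  moreover have "ends G ((es @ [e]) ! i) = {us ! i, us ! (Suc i mod length (es @ [e]))}"
    if "i < length (es @ [e])" for i
    using that path e(2) first last by (cases "i = length es") (auto simp: nth_append)
  ultimately have "is_cycle G us (es @ [e])"
    using len us es e(1) by (auto simp: is_cycle_def)
  then show False
    using F by (auto simp: forest_def)
qed

lemma forest_subgraph:
  assumes "forest G" "subgraph H G"
  shows "forest H"
proof -
  have "is_cycle G us es" if "is_cycle H us es" for us es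
    using that assms(2) by (auto simp: is_cycle_def subgraph_def)
  then show ?thesis
    using assms by (auto simp: forest_def subgraph_def)
qed

lemma num_components_no_edges:
  assumes "edges G = {}"
  shows "num_components G = card (verts G)"
proof -
  have "connectivity G = Id_on (verts G)"
    using assms by (auto simp: connectivity_def adjacency_def)
  then have "verts G // connectivity G = (\<lambda>z. {z}) ` verts G"
    by (auto simp: quotient_def)
  then show ?thesis
    by (simp add: num_components_def card_image)
qed

text \<open>Without edges every vertex is a component. Each edge deleted to get there is a bridge of the
  forest that is left, and so raises the number of components by one.\<close>

lemma forest_num_components:
  assumes "forest G"
  shows "num_components G + card (edges G) = card (verts G)"
  using assms
proof (induction "card (edges G)" arbitrary: G)
  case 0
  then have "edges G = {}"
    by (auto simp: forest_def is_graph_def)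
  then show ?case
    by (simp add: num_components_no_edges)
next
  case (Suc n)
  let ?G' = "\<lambda>e. G\<lparr>edges := edges G - {e}\<rparr>"
  have G: "is_graph G"
    using Suc by (simp add: forest_def)
  obtain e where e: "e \<in> edges G"
    using Suc(2) by (metis card.empty ex_in_conv nat.distinct(1))
  have "card (ends G e) \<in> {1, 2}"
    using G e by (auto simp: is_graph_def)
  then obtain a b where ab: "ends G e = {a, b}"
    by (auto simp: card_1_singleton_iff card_2_iff)
  have "subgraph (?G' e) G"
    using G by (auto simp: subgraph_def is_graph_def)
  then have "forest (?G' e)"
    using Suc forest_subgraph by blast
  have "finite (edges G)"
    using G by (simp add: is_graph_def)
  have "edges (?G' e) = edges G - {e}"
    by simp
  then have card: "card (edges G) = Suc (card (edges (?G' e)))"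
    using card.remove[OF \<open>finite (edges G)\<close> e] by (simp only:)
  then have "n = card (edges (?G' e))"
    using Suc(2) by linarith
  then have "num_components (?G' e) + card (edges (?G' e)) = card (verts (?G' e))"
    using Suc(1) \<open>forest (?G' e)\<close> by blast
  moreover have "verts (?G' e) = verts G"
    by simp
  ultimately have "num_components (?G' e) + card (edges (?G' e)) = card (verts G)"
    by (simp only:)
  then show ?case
    using num_components_delete_bridge[OF G e ab forest_edge_is_bridge[OF Suc(3) e ab]] card
    by linarith
qed

section \<open>Substitution\<close>

lemma subst_vx_add: "subst_vx (p + q) v x = subst_vx p v x + subst_vx q v x"
proof -
  have coeffwise: "map_poly f (r + s) = map_poly f r + map_poly f s"
    if "f 0 = 0" "\<And>c d. f (c + d) = f c + f d"
    for f :: "'b::comm_monoid_add \<Rightarrow> 'c::comm_monoid_add" and r s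
    using that by (intro poly_eqI) (simp add: coeff_map_poly)
  show ?thesis
    by (simp add: subst_vx_def coeffwise)
qed

lemma subst_vxy_add: "subst_vxy (p + q) v x y = subst_vxy p v x y + subst_vxy q v x y"
proof -
  have "map_poly (\<lambda>q. subst_vx q x y) (p + q) =
      map_poly (\<lambda>q. subst_vx q x y) p + map_poly (\<lambda>q. subst_vx q x y) q"
    by (intro poly_eqI) (simp add: coeff_map_poly subst_vx_add)
  then show ?thesis
    by (simp add: subst_vxy_def)
qed

lemma subst_vx_sum: "subst_vx (\<Sum>i\<in>I. p i) v x = (\<Sum>i\<in>I. subst_vx (p i) v x)"
  by (rule sum_comp_morphism[unfolded comp_def, symmetric]) (simp_all add: subst_vx_add)

lemma subst_vxy_sum: "subst_vxy (\<Sum>i\<in>I. p i) v x y = (\<Sum>i\<in>I. subst_vxy (p i) v x y)"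
  by (rule sum_comp_morphism[unfolded comp_def, symmetric])
    (simp_all add: subst_vxy_add, simp add: subst_vxy_def)

lemma to_fract_power: "to_fract (p ^ n) = to_fract p ^ n"
  by (induction n) simp_all

text \<open>Embedding a polynomial in the field of fractions is the same as evaluating it at the images of
  the indeterminates. In this form the left-hand side of the first identity is an evaluation in a
  commutative ring, like its right-hand side.\<close>

lemma to_fract_subgraph_counting_poly:
  "to_fract (subgraph_counting_poly G) =
    subst_vxy (subgraph_counting_poly G) (to_fract indet_v) (to_fract indet_x) (to_fract indet_y)"
proof -
  have "to_fract (monom (monom (monom 1 k) j) i :: int poly poly poly) =
      to_fract indet_v ^ i * to_fract indet_x ^ j * to_fract indet_y ^ k" for i j k
    by (simp add: to_fract_power flip: indet_monom)
  then show ?thesis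
    by (simp add: subgraph_counting_poly_def subst_vxy_sum subst_vxy_monom)
qed

lemma subst_subgraph_component_poly:
  "subst_vx (subgraph_component_poly G) v x =
    (\<Sum>W\<in>Pow (verts G). v ^ card W * x ^ num_components (induced G W))"
  by (simp add: subgraph_component_poly_def subst_vx_sum subst_vx_monom)

lemma subgraph_component_poly_eq_subst:
  "subgraph_component_poly G = subst_vx (subgraph_component_poly G) indet_v indet_x"
  unfolding subst_subgraph_component_poly
  by (simp add: subgraph_component_poly_def indet_v_def indet_x_def monom_altdef poly_const_pow
      smult_power [symmetric] algebra_simps)

section \<open>Summing over the edge sets of the subgraphs\<close>

lemma subgraph_of_induced_edges:
  assumes "is_graph G" "W \<subseteq> verts G" "A \<subseteq> edges (induced G W)"
  shows "subgraph \<lparr>verts = W, edges = A, ends = ends G\<rparr> G"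
proof -
  have "finite W" "finite A"
    using assms by (auto simp: is_graph_def induced_def intro: finite_subset)
  then show ?thesis
    using assms by (auto simp: subgraph_def is_graph_def induced_def)
qed

lemma forest_num_components_induced:
  assumes "forest F" "W \<subseteq> verts F"
  shows "num_components (induced F W) + card (edges (induced F W)) = card W"
proof -
  have "subgraph (induced F W) F"
    using assms subgraph_of_induced_edges[of F W "edges (induced F W)"]
    by (simp add: forest_def induced_def)
  then show ?thesis
    using forest_num_components[OF forest_subgraph[OF assms(1)]] by (fastforce simp: induced_def)
qed

text \<open>The edges of a subgraph with vertex set \<open>W\<close> have their ends in \<open>W\<close>, so they form an arbitrary
  set of edges of the induced subgraph on \<open>W\<close>.\<close>

lemma sum_subgraphs:
  assumes "is_graph G"
  shows "(\<Sum>H | subgraph H G. f H) =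
    (\<Sum>W\<in>Pow (verts G). \<Sum>A\<in>Pow (edges (induced G W)). f \<lparr>verts = W, edges = A, ends = ends G\<rparr>)"
proof -
  have fin: "finite (verts G)" "finite (edges G)"
    using assms by (auto simp: is_graph_def)
  have rebuild: "\<lparr>verts = verts H, edges = edges H, ends = ends G\<rparr> = H" if "subgraph H G" for H
    using that by (cases H) (simp add: subgraph_def)
  have "(\<Sum>H | subgraph H G. f H) =
    (\<Sum>(W, A)\<in>(SIGMA W:Pow (verts G). Pow (edges (induced G W))).
      f \<lparr>verts = W, edges = A, ends = ends G\<rparr>)"
  proof (rule sum.reindex_bij_witness[where i = "\<lambda>(W, A). \<lparr>verts = W, edges = A, ends = ends G\<rparr>"
        and j = "\<lambda>H. (verts H, edges H)"])
    fix H assume "H \<in> {H. subgraph H G}"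
    then show "(verts H, edges H) \<in> (SIGMA W:Pow (verts G). Pow (edges (induced G W)))"
      by (auto simp: subgraph_def is_graph_def induced_def) blast
  next
    fix P assume "P \<in> (SIGMA W:Pow (verts G). Pow (edges (induced G W)))"
    then show "(case P of (W, A) \<Rightarrow> \<lparr>verts = W, edges = A, ends = ends G\<rparr>) \<in> {H. subgraph H G}"
      using subgraph_of_induced_edges[OF assms] by auto
  qed (auto simp: rebuild)
  then show ?thesis
    using fin by (simp add: sum.Sigma induced_def)
qed

text \<open>Expanding the product of \<open>card B\<close> factors \<open>x + y\<close>: the set \<open>A\<close> records the factors from which
  \<open>y\<close> is taken.\<close>

lemma sum_Pow_binomial:
  fixes x y :: "'a::comm_semiring_1"
  assumes "finite B"
  shows "(\<Sum>A\<in>Pow B. x ^ (card B - card A) * y ^ card A) = (x + y) ^ card B"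
proof -
  have "(x + y) ^ card B = (\<Prod>b\<in>B. y + x)"
    by (simp add: add.commute)
  also have "\<dots> = (\<Sum>A\<in>Pow B. (\<Prod>b\<in>A. y) * (\<Prod>b\<in>B - A. x))"
    using assms by (rule prod_add)
  also have "\<dots> = (\<Sum>A\<in>Pow B. x ^ (card B - card A) * y ^ card A)"
    using assms by (intro sum.cong) (auto simp: card_Diff_subset finite_subset mult.commute)
  finally show ?thesis ..
qed

text \<open>For a fixed vertex set the number of components of a subgraph of a forest falls by one with each
  edge. The sum over the edge sets is thus a binomial expansion, with exponent the number of edges
  of the induced subgraph, which is \<open>card W - num_components (induced F W)\<close>.\<close>

lemma subst_subgraph_counting_poly_forest:
  assumes F: "forest F"
  shows "subst_vxy (subgraph_counting_poly F) v x y =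
    (\<Sum>W\<in>Pow (verts F). v ^ card W * x ^ num_components (induced F W) *
      (x + y) ^ (card W - num_components (induced F W)))"
proof -
  have G: "is_graph F" and fin: "finite (verts F)" "finite (edges F)"
    using F by (auto simp: forest_def is_graph_def)
  have "(\<Sum>A\<in>Pow (edges (induced F W)).
        v ^ card W * x ^ num_components \<lparr>verts = W, edges = A, ends = ends F\<rparr> * y ^ card A) =
      v ^ card W * x ^ num_components (induced F W) *
      (x + y) ^ (card W - num_components (induced F W))"
    if W: "W \<subseteq> verts F" for W
  proof -
    let ?E = "edges (induced F W)"
    have E: "finite ?E"
      using fin by (simp add: induced_def)
    have comps: "num_components \<lparr>verts = W, edges = A, ends = ends F\<rparr> + card A = card W"
      if A: "A \<subseteq> ?E" for A
    proof -
      have "subgraph \<lparr>verts = W, edges = A, ends = ends F\<rparr> F"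
        using G W A by (rule subgraph_of_induced_edges)
      then show ?thesis
        using forest_num_components[OF forest_subgraph[OF F]] by fastforce
    qed
    have induced: "num_components (induced F W) + card ?E = card W"
      using F W by (rule forest_num_components_induced)
    \<comment> \<open>Both the subgraph and the induced one satisfy vertices = components + edges; subtract.\<close>
    have "num_components \<lparr>verts = W, edges = A, ends = ends F\<rparr> =
        num_components (induced F W) + (card ?E - card A)" if A: "A \<subseteq> ?E" for A
      using comps[OF A] induced card_mono[OF E A] by linarith
    then have "(\<Sum>A\<in>Pow ?E.
          v ^ card W * x ^ num_components \<lparr>verts = W, edges = A, ends = ends F\<rparr> * y ^ card A) =
        (\<Sum>A\<in>Pow ?E. v ^ card W * x ^ num_components (induced F W) *
          (x ^ (card ?E - card A) * y ^ card A))"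
      by (intro sum.cong) (simp_all add: power_add mult.assoc)
    also have "\<dots> = v ^ card W * x ^ num_components (induced F W) * (x + y) ^ card ?E"
      using E by (simp add: sum_Pow_binomial flip: sum_distrib_left)
    also have "card ?E = card W - num_components (induced F W)"
      using induced by linarith
    finally show ?thesis .
  qed
  then show ?thesis
    by (simp add: subgraph_counting_poly_def subst_vxy_sum subst_vxy_monom sum_subgraphs[OF G])
qed

theorem theorem8:
  fixes F :: "('v, 'e) mgraph"
  assumes "forest F"
  shows "to_fract (subgraph_counting_poly F) =
           subst_vx (subgraph_component_poly F)
             (to_fract indet_v * (to_fract indet_x + to_fract indet_y))
             (to_fract indet_x / (to_fract indet_x + to_fract indet_y))
         \<and> subgraph_component_poly F =
           subst_vxy (subgraph_counting_poly F) indet_v indet_x (1 - indet_x)"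
proof
  let ?v = "to_fract indet_v :: int poly poly poly fract"
  let ?x = "to_fract indet_x :: int poly poly poly fract"
  let ?y = "to_fract indet_y :: int poly poly poly fract"
  have "indet_x + indet_y \<noteq> (0 :: int poly poly poly)"
    by (simp add: indet_x_def indet_y_def)
  then have nonzero: "?x + ?y \<noteq> 0"
    by (simp flip: to_fract_add)
  have le: "num_components (induced F W) \<le> card W" if "W \<subseteq> verts F" for W
    using forest_num_components_induced[OF assms that] by linarith
  \<comment> \<open>As \<open>k \<le> card W\<close>, the power \<open>(x + y) ^ (card W - k)\<close> is a quotient of powers of \<open>x + y\<close>.\<close>
  show "to_fract (subgraph_counting_poly F) =
      subst_vx (subgraph_component_poly F) (?v * (?x + ?y)) (?x / (?x + ?y))"
    unfolding to_fract_subgraph_counting_poly subst_subgraph_counting_poly_forest[OF assms]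
      subst_subgraph_component_poly
    using nonzero le by (intro sum.cong) (auto simp: power_mult_distrib power_divide power_diff)
  show "subgraph_component_poly F =
      subst_vxy (subgraph_counting_poly F) indet_v indet_x (1 - indet_x)"
    by (subst subgraph_component_poly_eq_subst)
      (simp add: subst_subgraph_counting_poly_forest[OF assms] subst_subgraph_component_poly)
qed

end
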